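(* Let $f:[0,1]\to\mathbb{R}$ be a continuous function of bounded variation on $[0,1]$, and let $\tilde f:\mathbb{R}\to\mathbb{R}$ be defined by $\tilde f(x):=f(\{x\})$, where $\{x\}:=x-\lfloor x\rfloor$ is the fractional part of $x$. Suppose that the Fourier series of $\tilde f$ is $$\tilde f(x)\sim a_0+\sum_{k=1}^{\infty}\big(a_k\cos(2\pi kx)+b_k\sin(2\pi kx)\big).$$ (1) If $f(1)\geq f(0)$ and the coefficients $a_n$ are decreasing for $n\geq1$, then $R_n(f)$ is monotonically decreasing relative to $n$. (2) If $f(0)\geq f(1)$ and the coefficients $a_n$ are decreasing for $n\geq1$, then $L_n(f)$ is monotonically decreasing relative to $n$. (3) If $f(0)\geq f(1)$ and the coefficients $a_n$ are increasing for $n\geq1$, then $R_n(f)$ is monotonically increasing relative to $n$. (4) If $f(1)\geq f(0)$ and the coefficients $a_n$ are increasing for $n\geq1$, then $L_n(f)$ is monotonically increasing relative to $n$.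
   Context: For $f:[0,1]\to\mathbb{R}$ and an integer $n\ge 1$, the left and right Riemann sums of $f$ are $L_n(f):=\frac1n\sum_{k=0}^{n-1}f\big(\tfrac kn\big)$ and $R_n(f):=\frac1n\sum_{k=1}^{n}f\big(\tfrac kn\big)$. The Fourier coefficients are $a_0=\int_0^1 f(x)\,dx$, $a_k=2\int_0^1 f(x)\cos(2\pi kx)\,dx$ and $b_k=2\int_0^1 f(x)\sin(2\pi kx)\,dx$ for $k\geq1$. "Increasing" and "decreasing" are meant in the weak (non-strict) sense, over integers $n\geq 1$. *)

theory Defs
  imports "HOL-Analysis.Analysis"
begin

definition bounded_variation_on :: "real \<Rightarrow> real \<Rightarrow> (real \<Rightarrow> real) \<Rightarrow> bool" where
  "bounded_variation_on a b f \<longleftrightarrow>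
     (\<exists>M. \<forall>(n::nat) (x::nat \<Rightarrow> real).
        x 0 = a \<and> x n = b \<and> strict_mono_on {..n} x \<longrightarrow>
        (\<Sum>i<n. \<bar>f (x (Suc i)) - f (x i)\<bar>) \<le> M)"

definition left_riemann_sum :: "(real \<Rightarrow> real) \<Rightarrow> nat \<Rightarrow> real" where
  "left_riemann_sum f n = 1 / real n * (\<Sum>k<n. f (real k / real n))"

definition right_riemann_sum :: "(real \<Rightarrow> real) \<Rightarrow> nat \<Rightarrow> real" where
  "right_riemann_sum f n = 1 / real n * (\<Sum>k=1..n. f (real k / real n))"

definition periodic_extension :: "(real \<Rightarrow> real) \<Rightarrow> real \<Rightarrow> real" where
  "periodic_extension f x = f (frac x)"

(* "g(x) ~ a 0 + (\<Sum>k\<ge>1. a k cos (2 pi k x) + b k sin (2 pi k x))" for a 1-periodic g.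
   As usual for "~", this only says what the coefficients are; no convergence of the
   series is asserted. There is no b 0 in the series, so b 0 is unconstrained. *)
definition has_fourier_series :: "(real \<Rightarrow> real) \<Rightarrow> (nat \<Rightarrow> real) \<Rightarrow> (nat \<Rightarrow> real) \<Rightarrow> bool" where
  "has_fourier_series g a b \<longleftrightarrow>
     a 0 = integral {0..1} g \<and>
     (\<forall>k\<ge>1. a k = 2 * integral {0..1} (\<lambda>x. g x * cos (2 * pi * real k * x)) \<and>
            b k = 2 * integral {0..1} (\<lambda>x. g x * sin (2 * pi * real k * x)))"

(* f and its periodic extension differ on {0..1} at most at 1, so the Fourier
   coefficients of the extension are the integrals of f itself. *)
lemma integral_periodic_extension:
  "integral {0..1} (\<lambda>x. periodic_extension f x * h x) = integral {0..1} (\<lambda>x. f x * h x)"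
proof (rule integral_spike)
  show "negligible {1::real}" by simp
  fix x :: real assume "x \<in> {0..1} - {1}"
  then have "frac x = x" by (simp add: frac_eq)
  then show "f x * h x = periodic_extension f x * h x"
    by (simp add: periodic_extension_def)
qed

lemma has_fourier_series_periodic_extension:
  "has_fourier_series (periodic_extension f) a b \<longleftrightarrow> has_fourier_series f a b"
  using integral_periodic_extension[of f "\<lambda>_. 1"]
  by (simp add: has_fourier_series_def integral_periodic_extension)

end

theory Submission
  imports Defs
begin

text \<open>
  Write \<open>T\<close> for the trapezoidal sum, the mean of the left and the right Riemann sum with \<open>n\<close>
  nodes. Poisson summation suggests \<open>T = a\<^sub>0 + (\<Sum>m\<ge>1. a\<^bsub>mn\<^esub>)\<close>. If \<open>a\<close> decreases, every
  term \<open>a\<^bsub>mn\<^esub>\<close> decreases in \<open>n\<close>, and hence so does \<open>T\<close>. The one-sided sums are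
  \<open>T \<plusminus> (f 1 - f 0) / (2 * n)\<close>, and the sign condition on \<open>f 1 - f 0\<close> says that this correction is
  monotone in the same direction as \<open>T\<close>.

  It is enough to have the Poisson formula in the sense of Cesaro means, because the termwise
  comparison already holds for all partial sums and passes to their means
  (\<open>trapezoidal_sum_cesaro\<close>). In this sense the formula is Fejer's theorem at an end
  point of the unit interval (\<open>fejer_endpoint\<close>), applied to the folded function
  \<open>x \<mapsto> (\<Sum>k<n. f ((x + k) / n)) / n\<close>: its values at 0 and 1 are the left and right
  Riemann sums of \<open>f\<close>, and its cosine coefficients are the \<open>a\<^bsub>mn\<^esub>\<close>
  (\<open>integral_riemann_fold\<close>).
\<close>

section \<open>The Fejer kernel\<close>

definition dirichlet_kernel :: "nat \<Rightarrow> real \<Rightarrow> real" where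
  "dirichlet_kernel k x = 1 + 2 * (\<Sum>m=1..k. cos (2 * pi * real m * x))"

definition fejer_kernel :: "nat \<Rightarrow> real \<Rightarrow> real" where
  "fejer_kernel N x = (\<Sum>k<N. dirichlet_kernel k x) / real N"

lemma sin_times_dirichlet_kernel:
  "sin (pi * x) * dirichlet_kernel k x = sin ((2 * real k + 1) * (pi * x))"
proof (induction k)
  case 0
  then show ?case by (simp add: dirichlet_kernel_def)
next
  case (Suc k)
  define u where "u = 2 * pi * real (Suc k) * x"
  have "dirichlet_kernel (Suc k) x = dirichlet_kernel k x + 2 * cos u"
    by (simp add: dirichlet_kernel_def u_def)
  then have "sin (pi * x) * dirichlet_kernel (Suc k) x
      = sin (u - pi * x) + 2 * sin (pi * x) * cos u"
    using Suc.IH by (simp add: u_def algebra_simps)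
  also have "\<dots> = sin (u + pi * x)"
    by (simp add: sin_add sin_diff)
  finally show ?case
    by (simp add: u_def algebra_simps)
qed

text \<open>
  The right-hand sides of \<open>sin_times_dirichlet_kernel\<close>, multiplied by \<open>sin (\<pi> x)\<close>, are
  differences of consecutive \<open>sin\<^sup>2 (k \<pi> x)\<close>, so the sum telescopes. Leaving
  \<open>sin\<^sup>2 (\<pi> x)\<close> as a factor keeps the closed form valid at the integers.
\<close>

lemma sin_squared_times_sum_dirichlet_kernel:
  "(sin (pi * x))\<^sup>2 * (\<Sum>k<N. dirichlet_kernel k x) = (sin (real N * (pi * x)))\<^sup>2"
proof (induction N)
  case 0
  then show ?case by simp
next
  case (Suc N)
  define v where "v = real N * (pi * x)"
  define w where "w = pi * x"
  have "(sin w)\<^sup>2 * dirichlet_kernel N x = sin w * sin ((2 * real N + 1) * w)"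
    using sin_times_dirichlet_kernel[of x N] by (simp add: power2_eq_square w_def)
  also have "(2 * real N + 1) * w = v + (v + w)"
    by (simp add: v_def w_def algebra_simps)
  also have "sin w * sin (v + (v + w)) = (sin (v + w))\<^sup>2 - (sin v)\<^sup>2"
  proof -
    have "sin ((v + w) - v) * sin (v + (v + w))
        = (sin (v + w))\<^sup>2 * (cos v)\<^sup>2 - (cos (v + w))\<^sup>2 * (sin v)\<^sup>2"
      unfolding sin_diff[of "v + w" v] sin_add[of v "v + w"]
      by (simp add: power2_eq_square algebra_simps)
    also have "\<dots> = (sin (v + w))\<^sup>2 - (sin v)\<^sup>2"
      by (simp only: cos_squared_eq) (simp add: algebra_simps)
    finally show ?thesis by simp
  qed
  finally have "(sin w)\<^sup>2 * dirichlet_kernel N x = (sin (v + w))\<^sup>2 - (sin v)\<^sup>2" .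
  moreover have "real (Suc N) * (pi * x) = v + w"
    by (simp add: v_def w_def algebra_simps)
  ultimately show ?case
    using Suc.IH by (simp add: v_def w_def algebra_simps)
qed

lemma sin_squared_times_fejer_kernel_le:
  "(sin (pi * x))\<^sup>2 * fejer_kernel N x \<le> 1 / real N"
proof -
  have "(sin (pi * x))\<^sup>2 * fejer_kernel N x = (sin (real N * (pi * x)))\<^sup>2 / real N"
    using sin_squared_times_sum_dirichlet_kernel[of x N] by (simp add: fejer_kernel_def)
  also have "\<dots> \<le> 1 / real N"
    by (intro divide_right_mono) (simp_all add: abs_square_le_1)
  finally show ?thesis .
qed

lemma fejer_kernel_nonneg: "fejer_kernel N x \<ge> 0"
proof (cases "sin (pi * x) = 0")
  case True
  \<comment> \<open>Here \<open>x\<close> is an integer and the closed form is the vacuous \<open>0 = 0\<close>, but every cosine is 1.\<close>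
  then obtain i :: int where i: "x = of_int i"
    by (auto simp: sin_zero_iff_int2)
  have "cos (2 * pi * real m * x) = 1" for m
    using cos_int_2pin[of "int m * i"] by (simp add: i mult.assoc)
  then show ?thesis
    by (simp add: fejer_kernel_def dirichlet_kernel_def sum_nonneg)
next
  case False
  then have "(sin (pi * x))\<^sup>2 > 0" by simp
  moreover have "(sin (pi * x))\<^sup>2 * (\<Sum>k<N. dirichlet_kernel k x) \<ge> 0"
    by (simp add: sin_squared_times_sum_dirichlet_kernel)
  ultimately have "(\<Sum>k<N. dirichlet_kernel k x) \<ge> 0"
    by (simp add: zero_le_mult_iff)
  then show ?thesis by (simp add: fejer_kernel_def)
qed

lemma continuous_on_dirichlet_kernel [continuous_intros]: "continuous_on S (dirichlet_kernel k)"
  unfolding dirichlet_kernel_def by (intro continuous_intros)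

lemma continuous_on_fejer_kernel [continuous_intros]: "continuous_on S (fejer_kernel N)"
  unfolding fejer_kernel_def divide_inverse by (intro continuous_intros)

lemma fejer_kernel_reflect: "fejer_kernel N (1 - x) = fejer_kernel N x"
proof -
  have "cos (2 * pi * real m * (1 - x)) = cos (2 * pi * real m * x)" for m
    using sin_2npi[of m] cos_2npi[of m] by (simp add: right_diff_distrib cos_diff mult_ac)
  then show ?thesis by (simp add: fejer_kernel_def dirichlet_kernel_def)
qed

lemma integral_mult_dirichlet_kernel:
  assumes g: "continuous_on {0..1} g"
  shows "integral {0..1} (\<lambda>x. g x * dirichlet_kernel k x) =
    integral {0..1} g + (\<Sum>m=1..k. 2 * integral {0..1} (\<lambda>x. g x * cos (2 * pi * real m * x)))"
proof -
  have "((\<lambda>x. g x * cos (2 * pi * real m * x)) has_integral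
      integral {0..1} (\<lambda>x. g x * cos (2 * pi * real m * x))) {0..1}" for m
    by (intro integrable_integral integrable_continuous_real continuous_intros g)
  moreover have "(g has_integral integral {0..1} g) {0..1}"
    by (intro integrable_integral integrable_continuous_real g)
  ultimately have "((\<lambda>x. g x + (\<Sum>m=1..k. 2 * (g x * cos (2 * pi * real m * x)))) has_integral
      integral {0..1} g + (\<Sum>m=1..k. 2 * integral {0..1} (\<lambda>x. g x * cos (2 * pi * real m * x)))) {0..1}"
    by (intro has_integral_add has_integral_sum has_integral_mult_right) auto
  then have "((\<lambda>x. g x * dirichlet_kernel k x) has_integral
      integral {0..1} g + (\<Sum>m=1..k. 2 * integral {0..1} (\<lambda>x. g x * cos (2 * pi * real m * x)))) {0..1}"
    by (simp add: dirichlet_kernel_def distrib_left sum_distrib_left mult.left_commute)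
  then show ?thesis by (rule integral_unique)
qed

lemma integral_mult_fejer_kernel:
  assumes g: "continuous_on {0..1} g"
  shows "integral {0..1} (\<lambda>x. g x * fejer_kernel N x) =
    (\<Sum>k<N. integral {0..1} (\<lambda>x. g x * dirichlet_kernel k x)) / real N"
proof -
  have "((\<lambda>x. g x * dirichlet_kernel k x) has_integral
      integral {0..1} (\<lambda>x. g x * dirichlet_kernel k x)) {0..1}" for k
    by (intro integrable_integral integrable_continuous_real continuous_intros g)
  then have "((\<lambda>x. (\<Sum>k<N. g x * dirichlet_kernel k x) / real N) has_integral
      (\<Sum>k<N. integral {0..1} (\<lambda>x. g x * dirichlet_kernel k x)) / real N) {0..1}"
    by (intro has_integral_divide has_integral_sum) auto
  then have "((\<lambda>x. g x * fejer_kernel N x) has_integral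
      (\<Sum>k<N. integral {0..1} (\<lambda>x. g x * dirichlet_kernel k x)) / real N) {0..1}"
    by (simp add: fejer_kernel_def sum_distrib_left)
  then show ?thesis by (rule integral_unique)
qed

lemma integral_fejer_kernel:
  assumes "N > 0"
  shows "integral {0..1} (fejer_kernel N) = 1"
proof -
  have cos0: "integral {0..1} (\<lambda>x. cos (2 * pi * real m * x)) = 0" if "m \<ge> 1" for m
  proof -
    have "((\<lambda>x. cos (2 * pi * real m * x)) has_integral
        sin (2 * pi * real m * 1) / (2 * pi * real m) - sin (2 * pi * real m * 0) / (2 * pi * real m))
        {0..1}"
      using that
      by (intro fundamental_theorem_of_calculus)
        (auto intro!: derivative_eq_intros simp flip: has_real_derivative_iff_has_vector_derivative)
    moreover have "sin (2 * pi * real m) = 0"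
      using sin_2npi[of m] by (simp add: mult_ac)
    ultimately show ?thesis by (simp add: integral_unique)
  qed
  have "integral {0..1} (\<lambda>x. 1 * dirichlet_kernel k x) = 1" for k
    by (subst integral_mult_dirichlet_kernel) (simp_all add: cos0)
  then show ?thesis
    using integral_mult_fejer_kernel[of "\<lambda>_. 1" N] assms by simp
qed

section \<open>Fejer's theorem at an end point\<close>

lemma integral_reflect_unit:
  fixes g :: "real \<Rightarrow> real"
  assumes "continuous_on {0..1} g"
  shows "integral {0..1} (\<lambda>x. g (1 - x)) = integral {0..1} g"
proof -
  have "((\<lambda>x. (-1) *\<^sub>R g (1 - x)) has_integral
      integral {1 - 0..1 - 1} g - integral {1 - 1..1 - 0} g) {0..1}"
    by (rule has_integral_substitution_general[of "{}" 0 1 "\<lambda>x. 1 - x" 0 1])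
      (auto intro!: continuous_intros derivative_eq_intros assms)
  then have "((\<lambda>x. - g (1 - x)) has_integral - integral {0..1} g) {0..1}"
    by simp
  from has_integral_neg[OF this] have "((\<lambda>x. g (1 - x)) has_integral integral {0..1} g) {0..1}"
    by simp
  then show ?thesis by (rule integral_unique)
qed

text \<open>
  A function vanishing at both ends is small except where \<open>sin\<^sup>2 (\<pi> x)\<close> is bounded away from 0.
  This bound serves in place of the usual splitting of the interval, because the Fejer kernel
  integrates \<open>sin\<^sup>2 (\<pi> x)\<close> to at most \<open>1 / N\<close>.
\<close>

lemma abs_le_eps_plus_sin_squared:
  fixes h :: "real \<Rightarrow> real"
  assumes h: "continuous_on {0..1} h" and "h 0 = 0" "h 1 = 0" and "e > 0"
  obtains C where "C \<ge> 0" "\<And>x. x \<in> {0..1} \<Longrightarrow> \<bar>h x\<bar> \<le> e + C * (sin (pi * x))\<^sup>2"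
proof -
  define K where "K = {x \<in> {0..1}. e \<le> \<bar>h x\<bar>}"
  have habs: "continuous_on {0..1} (\<lambda>x. \<bar>h x\<bar>)"
    by (intro continuous_intros h)
  have "K = {0..1} \<inter> (\<lambda>x. \<bar>h x\<bar>) -` {e..}"
    by (auto simp: K_def)
  then have "closed K"
    using continuous_closed_preimage[OF habs] by simp
  moreover have "K \<subseteq> {0..1}"
    by (auto simp: K_def)
  ultimately have "compact K"
    using compact_Int_closed[OF compact_Icc, of K 0 1] by (simp add: Int_absorb1)
  have pos: "sin (pi * x) > 0" if "x \<in> K" for x
  proof -
    from that assms have "x \<noteq> 0" "x \<noteq> 1" "0 \<le> x" "x \<le> 1"
      by (auto simp: K_def)
    then show ?thesis
      by (intro sin_gt_zero) auto
  qed
  have "continuous_on K (\<lambda>x. \<bar>h x\<bar> / (sin (pi * x))\<^sup>2)"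
    using pos by (intro continuous_intros continuous_on_subset[OF habs \<open>K \<subseteq> {0..1}\<close>]) force
  then have "bounded ((\<lambda>x. \<bar>h x\<bar> / (sin (pi * x))\<^sup>2) ` K)"
    using \<open>compact K\<close> by (intro compact_imp_bounded compact_continuous_image)
  then obtain C where "C > 0" and C: "\<And>x. x \<in> K \<Longrightarrow> \<bar>h x\<bar> / (sin (pi * x))\<^sup>2 \<le> C"
    unfolding bounded_pos by (auto simp: abs_le_iff)
  have "\<bar>h x\<bar> \<le> e + C * (sin (pi * x))\<^sup>2" if "x \<in> {0..1}" for x
  proof (cases "x \<in> K")
    case True
    then show ?thesis
      using C[OF True] pos[OF True] \<open>e > 0\<close> by (simp add: pos_divide_le_eq)
  next
    case False
    then have "\<bar>h x\<bar> \<le> e" using that by (auto simp: K_def)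
    moreover have "C * (sin (pi * x))\<^sup>2 \<ge> 0" using \<open>C > 0\<close> by simp
    ultimately show ?thesis by linarith
  qed
  with \<open>C > 0\<close> show ?thesis
    by (intro that[of C]) auto
qed

text \<open>
  The kernel is symmetric about \<open>1 / 2\<close>, so only the even part of \<open>g\<close> matters; its two
  boundary values agree and equal the limit.
\<close>

theorem fejer_endpoint:
  assumes g: "continuous_on {0..1} g"
  shows "(\<lambda>N. integral {0..1} (\<lambda>x. g x * fejer_kernel N x)) \<longlonglongrightarrow> (g 0 + g 1) / 2"
proof (rule LIMSEQ_I)
  fix r :: real assume "r > 0"
  define c where "c = (g 0 + g 1) / 2"
  define h where "h = (\<lambda>x. (g x + g (1 - x)) / 2 - c)"
  have g': "continuous_on {0..1} (\<lambda>x. g (1 - x))"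
    by (rule continuous_on_compose2[OF g]) (auto intro!: continuous_intros)
  have h: "continuous_on {0..1} h"
    unfolding h_def by (intro continuous_intros g g') auto
  have h0: "h 0 = 0" "h 1 = 0"
    by (simp_all add: h_def c_def add.commute)
  obtain C where "C \<ge> 0" and C: "\<And>x. x \<in> {0..1} \<Longrightarrow> \<bar>h x\<bar> \<le> r / 2 + C * (sin (pi * x))\<^sup>2"
    using abs_le_eps_plus_sin_squared[OF h h0, of "r / 2"] \<open>r > 0\<close> by auto
  have bound: "\<bar>integral {0..1} (\<lambda>x. g x * fejer_kernel N x) - c\<bar> \<le> r / 2 + C / real N"
    if "N > 0" for N
  proof -
    let ?F = "fejer_kernel N"
    have I1: "(?F has_integral 1) {0..1}"
      using integral_fejer_kernel[OF that] integrable_continuous_real[OF continuous_on_fejer_kernel]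
      by (simp add: has_integral_iff)
    have Ig: "((\<lambda>x. g x * ?F x) has_integral integral {0..1} (\<lambda>x. g x * ?F x)) {0..1}"
      by (intro integrable_integral integrable_continuous_real continuous_intros g)
    have Ig': "((\<lambda>x. g (1 - x) * ?F x) has_integral integral {0..1} (\<lambda>x. g x * ?F x)) {0..1}"
    proof -
      have "integral {0..1} (\<lambda>x. g (1 - x) * ?F x) = integral {0..1} (\<lambda>x. g x * ?F x)"
        using integral_reflect_unit[of "\<lambda>x. g x * ?F x"]
        by (simp add: fejer_kernel_reflect continuous_on_mult g continuous_on_fejer_kernel)
      moreover have "(\<lambda>x. g (1 - x) * ?F x) integrable_on {0..1}"
        by (intro integrable_continuous_real continuous_intros g')
      ultimately show ?thesis by (simp add: has_integral_iff)
    qed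
    have "((\<lambda>x. (g x * ?F x + g (1 - x) * ?F x) / 2 - c * ?F x) has_integral
        (integral {0..1} (\<lambda>x. g x * ?F x) + integral {0..1} (\<lambda>x. g x * ?F x)) / 2 - c * 1) {0..1}"
      by (intro has_integral_diff has_integral_divide has_integral_add has_integral_mult_right
          Ig Ig' I1)
    then have Ih: "((\<lambda>x. h x * ?F x) has_integral integral {0..1} (\<lambda>x. g x * ?F x) - c) {0..1}"
      by (simp add: h_def algebra_simps add_divide_distrib)
    have Ib: "((\<lambda>x. r / 2 * ?F x + C / real N) has_integral r / 2 * 1 + C / real N) {0..1}"
      using has_integral_const_real[of "C / real N" 0 1]
      by (intro has_integral_add has_integral_mult_right I1) auto
    have le: "\<bar>h x * ?F x\<bar> \<le> r / 2 * ?F x + C / real N" if "x \<in> {0..1}" for x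
    proof -
      have "\<bar>h x * ?F x\<bar> \<le> (r / 2 + C * (sin (pi * x))\<^sup>2) * ?F x"
        using C[OF that] fejer_kernel_nonneg[of N x]
        by (simp add: abs_mult mult_right_mono)
      also have "\<dots> = r / 2 * ?F x + C * ((sin (pi * x))\<^sup>2 * ?F x)"
        by (simp add: algebra_simps)
      also have "\<dots> \<le> r / 2 * ?F x + C * (1 / real N)"
        by (intro add_left_mono mult_left_mono sin_squared_times_fejer_kernel_le \<open>C \<ge> 0\<close>)
      finally show ?thesis by simp
    qed
    have "norm (integral {0..1} (\<lambda>x. h x * ?F x)) \<le> integral {0..1} (\<lambda>x. r / 2 * ?F x + C / real N)"
      using Ih Ib le by (intro integral_norm_bound_integral) (auto simp: has_integral_iff)
    then show ?thesis
      using Ih Ib by (simp add: has_integral_iff)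
  qed
  have "(\<lambda>N. C / real N) \<longlonglongrightarrow> 0"
    by (rule lim_const_over_n)
  then have "\<forall>\<^sub>F N in sequentially. C / real N < r / 2"
    using \<open>r > 0\<close> by (intro order_tendstoD) auto
  then have "\<forall>\<^sub>F N in sequentially. N > 0 \<and> C / real N < r / 2"
    using eventually_gt_at_top[of 0] by eventually_elim auto
  then obtain N0 where N0: "\<And>N. N \<ge> N0 \<Longrightarrow> N > 0 \<and> C / real N < r / 2"
    unfolding eventually_sequentially by auto
  have "norm (integral {0..1} (\<lambda>x. g x * fejer_kernel N x) - c) < r" if "N \<ge> N0" for N
    using bound[of N] N0[OF that] by (auto simp del: less_divide_eq_numeral1)
  then show "\<exists>N0. \<forall>N\<ge>N0. norm (integral {0..1} (\<lambda>x. g x * fejer_kernel N x) - (g 0 + g 1) / 2) < r"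
    unfolding c_def by blast
qed

section \<open>Trapezoidal sums as Cesaro sums of Fourier coefficients\<close>

definition riemann_fold :: "nat \<Rightarrow> (real \<Rightarrow> real) \<Rightarrow> real \<Rightarrow> real" where
  "riemann_fold n f x = (\<Sum>k<n. f ((x + real k) / real n)) / real n"

lemma riemann_fold_0: "riemann_fold n f 0 = left_riemann_sum f n"
  by (simp add: riemann_fold_def left_riemann_sum_def)

lemma riemann_fold_1: "riemann_fold n f 1 = right_riemann_sum f n"
proof -
  have "(\<Sum>k<n. f ((1 + real k) / real n)) = (\<Sum>k=1..n. f (real k / real n))"
    by (rule sum.reindex_bij_witness[of _ "\<lambda>k. k - 1" Suc]) (auto simp: Suc_le_eq)
  then show ?thesis by (simp add: riemann_fold_def right_riemann_sum_def)
qed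

lemma fold_node_in_unit:
  assumes "k < n" "x \<in> {0..1}"
  shows "(x + real k) / real n \<in> {0..1}"
proof -
  have "x + real k \<le> real n" using assms by auto
  then show ?thesis using assms by auto
qed

lemma continuous_on_fold_summand:
  assumes "continuous_on {0..1} f" "k < n"
  shows "continuous_on {0..1} (\<lambda>x. f ((x + real k) / real n))"
  by (rule continuous_on_compose2[OF assms(1)])
    (use assms(2) in \<open>auto intro!: continuous_intros fold_node_in_unit simp del: atLeastAtMost_iff\<close>)

lemma continuous_on_riemann_fold:
  assumes "continuous_on {0..1} f"
  shows "continuous_on {0..1} (riemann_fold n f)"
proof -
  have "continuous_on {0..1} (\<lambda>x. (\<Sum>k<n. f ((x + real k) / real n)) * inverse (real n))"
    by (intro continuous_on_mult_right continuous_on_sum continuous_on_fold_summand assms) auto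
  then show ?thesis
    by (simp add: riemann_fold_def[abs_def] divide_inverse)
qed

text \<open>
  The summand with index \<open>k\<close> contributes the integral over the \<open>k\<close>-th of the \<open>n\<close> subintervals.
\<close>

lemma integral_riemann_fold:
  assumes f: "continuous_on {0..1} f" and "n > 0"
  shows "integral {0..1} (riemann_fold n f) = integral {0..1} f"
proof -
  have piece: "((\<lambda>x. f ((x + real k) / real n) / real n) has_integral
      integral {real k / real n..real (Suc k) / real n} f) {0..1}" if "k < n" for k
  proof -
    have "((\<lambda>x. (1 / real n) *\<^sub>R f ((x + real k) / real n)) has_integral
        integral {(0 + real k) / real n..(1 + real k) / real n} f) {0..1}"
      using that fold_node_in_unit[OF that]
      by (intro has_integral_substitution[of 0 1 "\<lambda>x. (x + real k) / real n" 0 1])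
        (auto intro!: derivative_eq_intros f divide_right_mono)
    then show ?thesis by (simp add: add.commute)
  qed
  have "(\<Sum>k<j. integral {real k / real n..real (Suc k) / real n} f) = integral {0..real j / real n} f"
    if "j \<le> n" for j
    using that
  proof (induction j)
    case 0
    then show ?case by simp
  next
    case (Suc j)
    have "f integrable_on {0..real (Suc j) / real n}"
      using Suc.prems \<open>n > 0\<close>
      by (intro integrable_continuous_real continuous_on_subset[OF f]) auto
    then have "integral {0..real j / real n} f + integral {real j / real n..real (Suc j) / real n} f
        = integral {0..real (Suc j) / real n} f"
      by (intro Henstock_Kurzweil_Integration.integral_combine) (auto intro!: divide_right_mono)
    then show ?case using Suc by simp
  qed
  from this[of n] have sum: "(\<Sum>k<n. integral {real k / real n..real (Suc k) / real n} f)
      = integral {0..1} f"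
    using \<open>n > 0\<close> by simp
  have "((\<lambda>x. \<Sum>k<n. f ((x + real k) / real n) / real n) has_integral
      (\<Sum>k<n. integral {real k / real n..real (Suc k) / real n} f)) {0..1}"
    by (intro has_integral_sum piece) auto
  then have "(riemann_fold n f has_integral integral {0..1} f) {0..1}"
    unfolding sum by (simp add: riemann_fold_def[abs_def] sum_divide_distrib)
  then show ?thesis by (rule integral_unique)
qed

lemma integral_riemann_fold_mult_cos:
  assumes f: "continuous_on {0..1} f" and "n > 0"
  shows "integral {0..1} (\<lambda>x. riemann_fold n f x * cos (2 * pi * real m * x)) =
    integral {0..1} (\<lambda>x. f x * cos (2 * pi * real (m * n) * x))"
proof -
  have cos_node: "cos (2 * pi * real (m * n) * ((x + real k) / real n)) = cos (2 * pi * real m * x)" for k x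
  proof -
    have "2 * pi * real (m * n) * ((x + real k) / real n)
        = 2 * pi * real m * x + 2 * pi * of_int (int (m * k))"
      using \<open>n > 0\<close> by (simp add: field_simps)
    then show ?thesis
      by (metis cos_add cos_int_2pin sin_int_2pin mult.right_neutral mult_zero_right diff_zero)
  qed
  have "riemann_fold n (\<lambda>x. f x * cos (2 * pi * real (m * n) * x))
      = (\<lambda>x. riemann_fold n f x * cos (2 * pi * real m * x))"
    unfolding riemann_fold_def cos_node by (simp add: fun_eq_iff flip: sum_distrib_right)
  then show ?thesis
    using integral_riemann_fold[of "\<lambda>x. f x * cos (2 * pi * real (m * n) * x)" n] \<open>n > 0\<close> f
    by (simp add: continuous_intros)
qed

text \<open>
  Folding keeps exactly the frequencies divisible by \<open>n\<close>, so the Fourier series of the folded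
  function at 0 is the Poisson series. Its Cesaro means converge by Fejer's theorem.
\<close>

theorem trapezoidal_sum_cesaro:
  assumes f: "continuous_on {0..1} f" and F: "has_fourier_series f a b" and n: "n > 0"
  shows "(\<lambda>N. (\<Sum>k<N. a 0 + (\<Sum>m=1..k. a (m * n))) / real N)
    \<longlonglongrightarrow> (left_riemann_sum f n + right_riemann_sum f n) / 2"
proof -
  have coeff: "2 * integral {0..1} (\<lambda>x. riemann_fold n f x * cos (2 * pi * real m * x)) = a (m * n)"
    if "m \<ge> 1" for m
    using F that n unfolding integral_riemann_fold_mult_cos[OF f n] has_fourier_series_def by simp
  have "a 0 = integral {0..1} (riemann_fold n f)"
    using F integral_riemann_fold[OF f n] by (simp add: has_fourier_series_def)
  then have "integral {0..1} (\<lambda>x. riemann_fold n f x * dirichlet_kernel k x)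
      = a 0 + (\<Sum>m=1..k. a (m * n))" for k
    unfolding integral_mult_dirichlet_kernel[OF continuous_on_riemann_fold[OF f]]
    by (simp add: coeff)
  then show ?thesis
    using fejer_endpoint[OF continuous_on_riemann_fold[OF f, of n]]
    by (simp add: integral_mult_fejer_kernel[OF continuous_on_riemann_fold[OF f]] riemann_fold_0 riemann_fold_1)
qed

section \<open>Monotonicity of Riemann sums\<close>

lemma trapezoidal_sum_le:
  assumes f: "continuous_on {0..1} f" and F: "has_fourier_series f a b"
    and "n > 0" "n' > 0" and le: "\<And>m. m \<ge> 1 \<Longrightarrow> a (m * n) \<le> a (m * n')"
  shows "left_riemann_sum f n + right_riemann_sum f n
    \<le> left_riemann_sum f n' + right_riemann_sum f n'"
proof -
  have "(\<Sum>k<N. a 0 + (\<Sum>m=1..k. a (m * n))) / real N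
      \<le> (\<Sum>k<N. a 0 + (\<Sum>m=1..k. a (m * n'))) / real N" for N
    by (intro divide_right_mono sum_mono add_left_mono le) auto
  then have "(left_riemann_sum f n + right_riemann_sum f n) / 2
      \<le> (left_riemann_sum f n' + right_riemann_sum f n') / 2"
    using trapezoidal_sum_cesaro[OF f F \<open>n > 0\<close>] trapezoidal_sum_cesaro[OF f F \<open>n' > 0\<close>]
    by (intro LIMSEQ_le) auto
  then show ?thesis by simp
qed

lemma right_minus_left_riemann_sum:
  assumes "n > 0"
  shows "right_riemann_sum f n - left_riemann_sum f n = (f 1 - f 0) / real n"
proof -
  have "(\<Sum>k=1..n. f (real k / real n)) + f 0 = (\<Sum>k<n. f (real k / real n)) + f 1"
  proof -
    have "(\<Sum>k=1..n. f (real k / real n)) + f (real 0 / real n) = (\<Sum>k\<le>n. f (real k / real n))"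
      by (simp add: atMost_atLeast0 sum.atLeast_Suc_atMost[of 0 n])
    also have "\<dots> = (\<Sum>k<n. f (real k / real n)) + f (real n / real n)"
      by (simp flip: lessThan_Suc_atMost)
    finally show ?thesis using assms by simp
  qed
  then have eq: "(\<Sum>k=1..n. f (real k / real n)) = (\<Sum>k<n. f (real k / real n)) + (f 1 - f 0)"
    by simp
  show ?thesis
    unfolding right_riemann_sum_def left_riemann_sum_def eq using assms by (simp add: field_simps)
qed

theorem corollary2p10:
  fixes f :: "real \<Rightarrow> real" and a b :: "nat \<Rightarrow> real"
  assumes "continuous_on {0..1} f"
    and "bounded_variation_on 0 1 f"
    and "has_fourier_series (periodic_extension f) a b"
  shows "(f 1 \<ge> f 0 \<and> antimono_on {1..} a \<longrightarrow> antimono_on {1..} (right_riemann_sum f)) \<and>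
         (f 0 \<ge> f 1 \<and> antimono_on {1..} a \<longrightarrow> antimono_on {1..} (left_riemann_sum f)) \<and>
         (f 0 \<ge> f 1 \<and> mono_on {1..} a \<longrightarrow> mono_on {1..} (right_riemann_sum f)) \<and>
         (f 1 \<ge> f 0 \<and> mono_on {1..} a \<longrightarrow> mono_on {1..} (left_riemann_sum f))"
proof -
  have F: "has_fourier_series f a b"
    using assms(3) by (simp add: has_fourier_series_periodic_extension)
  let ?L = "left_riemann_sum f" and ?R = "right_riemann_sum f"
  have down: "?L q + ?R q \<le> ?L p + ?R p" if "antimono_on {1..} a" "p \<in> {1..}" "p \<le> q" for p q
  proof (rule trapezoidal_sum_le[OF assms(1) F])
    fix m :: nat assume "m \<ge> 1"
    then have "m * p \<in> {1..}" "m * q \<in> {1..}" "m * p \<le> m * q"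
      using that by auto
    then show "a (m * q) \<le> a (m * p)"
      using that(1) by (simp add: monotone_on_def)
  qed (use that in auto)
  have up: "?L p + ?R p \<le> ?L q + ?R q" if "mono_on {1..} a" "p \<in> {1..}" "p \<le> q" for p q
  proof (rule trapezoidal_sum_le[OF assms(1) F])
    fix m :: nat assume "m \<ge> 1"
    then have "m * p \<in> {1..}" "m * q \<in> {1..}" "m * p \<le> m * q"
      using that by auto
    then show "a (m * p) \<le> a (m * q)"
      using that(1) by (simp add: monotone_on_def)
  qed (use that in auto)
  have pos: "?R q - ?L q \<le> ?R p - ?L p" if "f 0 \<le> f 1" "p \<in> {1..}" "p \<le> q" for p q
    using that by (simp add: right_minus_left_riemann_sum divide_left_mono)
  have neg: "?R p - ?L p \<le> ?R q - ?L q" if "f 1 \<le> f 0" "p \<in> {1..}" "p \<le> q" for p q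
    using that by (simp add: right_minus_left_riemann_sum divide_left_mono_neg)
  have "antimono_on {1..} ?R" if "f 0 \<le> f 1" "antimono_on {1..} a"
    by (rule monotone_onI) (use down[OF that(2)] pos[OF that(1)] in fastforce)
  moreover have "antimono_on {1..} ?L" if "f 1 \<le> f 0" "antimono_on {1..} a"
    by (rule monotone_onI) (use down[OF that(2)] neg[OF that(1)] in fastforce)
  moreover have "mono_on {1..} ?R" if "f 1 \<le> f 0" "mono_on {1..} a"
    by (rule monotone_onI) (use up[OF that(2)] neg[OF that(1)] in fastforce)
  moreover have "mono_on {1..} ?L" if "f 0 \<le> f 1" "mono_on {1..} a"
    by (rule monotone_onI) (use up[OF that(2)] pos[OF that(1)] in fastforce)
  ultimately show ?thesis by blast
qed

end
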